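(* Let $X_1$ and $X_2$ be random variables with continuous distribution functions $F_1$ and $F_2$ and densities $f_1$ and $f_2$ respectively. Let $U_1,\dots,U_n$ be mutually independent random variables with $U_i\sim Kw\text{-}G(\alpha_i,\beta_i,F_1)$, and let $V_1,\dots,V_n$ be mutually independent random variables with $V_i\sim Kw\text{-}G(\alpha_i,\delta_i,F_2)$, $i=1,\dots,n$. Write $\boldsymbol\alpha=(\alpha_1,\dots,\alpha_n)$, $\boldsymbol\beta=(\beta_1,\dots,\beta_n)$, $\boldsymbol\delta=(\delta_1,\dots,\delta_n)$, and suppose that $\boldsymbol\beta\stackrel{m}{\succeq}\boldsymbol\delta$ and $\boldsymbol\alpha\in\mathcal{D}_+$. (i) If $\boldsymbol\beta,\boldsymbol\delta\in\mathcal{E}_+$, then $X_1\le_{st}X_2$ implies $U_{1:n}\le_{st}V_{1:n}$. (ii) If $\boldsymbol\beta,\boldsymbol\delta\in\mathcal{D}_+$, then $X_1\ge_{st}X_2$ implies $U_{1:n}\ge_{st}V_{1:n}$.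
   Context: For $\alpha,\beta>0$ and a distribution function $F$, $X\sim Kw\text{-}G(\alpha,\beta,F)$ means that $X$ has distribution function $x\mapsto 1-(1-F^{\alpha}(x))^{\beta}$, $x\in\mathbb{R}$, where $F^\alpha(x)=(F(x))^\alpha$. $U_{1:n}=\min(U_1,\dots,U_n)$ and $V_{1:n}=\min(V_1,\dots,V_n)$. $\mathcal{D}_+=\{(x_1,\dots,x_n): x_1\ge x_2\ge\cdots\ge x_n>0\}$ and $\mathcal{E}_+=\{(x_1,\dots,x_n): 0<x_1\le x_2\le\cdots\le x_n\}$. For real vectors $\mathbf{x},\mathbf{y}$ of length $n$ with increasing rearrangements $x_{(1)}\le\cdots\le x_{(n)}$ and $y_{(1)}\le\cdots\le y_{(n)}$, $\mathbf{x}\stackrel{m}{\succeq}\mathbf{y}$ ($\mathbf{x}$ majorizes $\mathbf{y}$) means $\sum_{i=1}^j x_{(i)}\le\sum_{i=1}^j y_{(i)}$ for $j=1,\dots,n-1$ and $\sum_{i=1}^n x_{(i)}=\sum_{i=1}^n y_{(i)}$. Usual stochastic order: $X\le_{st}Y$ (equivalently $Y\ge_{st}X$) means $F_X(t)\ge F_Y(t)$ for all $t$, where $F_X,F_Y$ are the distribution functions of $X,Y$. *)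

theory Defs
  imports "HOL-Probability.Probability"
begin

text \<open>Vectors of length \<open>n\<close> are functions on \<open>nat\<close>; only the entries with index in \<open>{1..n}\<close> matter.\<close>

definition rearr :: "nat \<Rightarrow> (nat \<Rightarrow> real) \<Rightarrow> nat \<Rightarrow> real" where
  \<comment> \<open>\<open>rearr n x i\<close> is the \<open>i\<close>-th smallest entry, for \<open>i\<close> in \<open>{1..n}\<close>; list positions start at 0\<close>
  "rearr n x i = sort (map x [1..<Suc n]) ! (i - 1)"

definition majorizes :: "nat \<Rightarrow> (nat \<Rightarrow> real) \<Rightarrow> (nat \<Rightarrow> real) \<Rightarrow> bool" where
  "majorizes n x y \<longleftrightarrow>
     (\<forall>j\<in>{1..<n}. (\<Sum>i=1..j. rearr n x i) \<le> (\<Sum>i=1..j. rearr n y i)) \<and>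
     (\<Sum>i=1..n. rearr n x i) = (\<Sum>i=1..n. rearr n y i)"

definition D_plus :: "nat \<Rightarrow> (nat \<Rightarrow> real) set" where
  "D_plus n = {x. (\<forall>i\<in>{1..n}. \<forall>j\<in>{1..n}. i \<le> j \<longrightarrow> x i \<ge> x j) \<and> (\<forall>i\<in>{1..n}. x i > 0)}"

definition E_plus :: "nat \<Rightarrow> (nat \<Rightarrow> real) set" where
  "E_plus n = {x. (\<forall>i\<in>{1..n}. \<forall>j\<in>{1..n}. i \<le> j \<longrightarrow> x i \<le> x j) \<and> (\<forall>i\<in>{1..n}. x i > 0)}"

definition dist_fun :: "'a measure \<Rightarrow> ('a \<Rightarrow> real) \<Rightarrow> real \<Rightarrow> real" where
  "dist_fun M X = cdf (distr M borel X)"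

text \<open>Both bases of \<open>powr\<close> below lie in \<open>[0, 1]\<close> when \<open>F\<close> is a distribution function, and
  \<open>0 powr a = 0\<close> is the intended value because the exponents are positive.\<close>

definition KwG :: "'a measure \<Rightarrow> ('a \<Rightarrow> real) \<Rightarrow> real \<Rightarrow> real \<Rightarrow> (real \<Rightarrow> real) \<Rightarrow> bool" where
  "KwG M X \<alpha> \<beta> F \<longleftrightarrow>
     \<alpha> > 0 \<and> \<beta> > 0 \<and> X \<in> borel_measurable M \<and>
     (\<forall>x. dist_fun M X x = 1 - (1 - F x powr \<alpha>) powr \<beta>)"

text \<open>The two variables may live on different probability spaces.\<close>

definition le_st :: "'a measure \<Rightarrow> ('a \<Rightarrow> real) \<Rightarrow> 'b measure \<Rightarrow> ('b \<Rightarrow> real) \<Rightarrow> bool" where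
  "le_st M X N Y \<longleftrightarrow> (\<forall>t. dist_fun M X t \<ge> dist_fun N Y t)"

definition min_var :: "nat \<Rightarrow> (nat \<Rightarrow> 'a \<Rightarrow> real) \<Rightarrow> 'a \<Rightarrow> real" where
  "min_var n U = (\<lambda>\<omega>. MIN i\<in>{1..n}. U i \<omega>)"

end

theory Submission
  imports Defs
begin

text \<open>The survival function of the minimum is \<open>\<Prod>i. (1 - F t powr \<alpha> i) powr \<beta> i\<close>, which is
  decreasing in \<open>F t\<close>. For fixed \<open>0 \<le> F t < 1\<close> its logarithm is linear in \<open>\<beta>\<close>, with coefficients
  \<open>ln (1 - F t powr \<alpha> i)\<close> decreasing in \<open>i\<close>, so summation by parts compares the values at \<open>\<beta>\<close>
  and \<open>\<delta>\<close> by means of the partial sums occurring in majorization.\<close>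

lemma rearr_E_plus:
  assumes "x \<in> E_plus n" "i \<in> {1..n}"
  shows "rearr n x i = x i"
proof -
  have "sorted (map x [1..<Suc n])"
    using assms(1) by (auto simp: sorted_iff_nth_mono E_plus_def simp del: upt_Suc)
  moreover obtain k where "i = Suc k" "k < n"
    using assms(2) by (cases i) auto
  ultimately show ?thesis
    by (simp add: rearr_def sorted_sort_id del: upt_Suc)
qed

text \<open>The reversal of a decreasing list is sorted, and a sorted permutation of a list is its
  \<open>sort\<close>. The index reflects as \<open>n + 1 - i\<close> because vectors are indexed
  from 1.\<close>

lemma rearr_D_plus:
  assumes "x \<in> D_plus n" "i \<in> {1..n}"
  shows "rearr n x i = x (n + 1 - i)"
proof -
  have "sorted (rev (map x [1..<Suc n]))"
    using assms(1) by (auto simp: sorted_iff_nth_mono rev_nth D_plus_def simp del: upt_Suc)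
  then have "sort (map x [1..<Suc n]) = rev (map x [1..<Suc n])"
    by (intro properties_for_sort) simp_all
  moreover obtain k where "i = Suc k" "k < n"
    using assms(2) by (cases i) auto
  ultimately show ?thesis
    by (simp add: rearr_def rev_nth Suc_diff_Suc del: upt_Suc)
qed

text \<open>Abel summation as an induction: replacing the weight \<open>l n\<close> by the smaller
  \<open>l (Suc n)\<close> can only lower the left side, since the partial sum it multiplies is
  nonnegative.\<close>

lemma sum_mult_antimono_ge:
  fixes c l :: "nat \<Rightarrow> real"
  assumes "\<And>j. j \<in> {1..<n} \<Longrightarrow> 0 \<le> (\<Sum>i=1..j. c i)"
    and "\<And>j. j \<in> {1..<n} \<Longrightarrow> l (Suc j) \<le> l j"
  shows "l n * (\<Sum>i=1..n. c i) \<le> (\<Sum>i=1..n. c i * l i)"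
  using assms
proof (induction n)
  case 0
  then show ?case by simp
next
  case (Suc n)
  have "l (Suc n) * (\<Sum>i=1..n. c i) \<le> l n * (\<Sum>i=1..n. c i)"
    \<comment> \<open>The index \<open>n\<close> lies in \<open>{1..<Suc n}\<close> only if
      \<open>n > 0\<close>; for \<open>n = 0\<close> the sums are empty.\<close>
    using Suc.prems[of n] by (cases "n = 0") (auto intro: mult_right_mono)
  moreover have "l n * (\<Sum>i=1..n. c i) \<le> (\<Sum>i=1..n. c i * l i)"
    using Suc by simp
  ultimately show ?case
    by (simp add: algebra_simps)
qed

text \<open>Summation by parts for the differences \<open>rearr n y i - rearr n x i\<close>:
  majorization makes their partial sums nonnegative and their total zero, so the lower bound is 0
  whatever the sign of \<open>l n\<close>.\<close>

lemma majorizes_sum_le: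
  assumes maj: "majorizes n x y"
    and l: "\<And>j. j \<in> {1..<n} \<Longrightarrow> l (Suc j) \<le> l j"
  shows "(\<Sum>i=1..n. rearr n x i * l i) \<le> (\<Sum>i=1..n. rearr n y i * l i)"
proof -
  have "l n * (\<Sum>i=1..n. rearr n y i - rearr n x i)
      \<le> (\<Sum>i=1..n. (rearr n y i - rearr n x i) * l i)"
    using maj l by (intro sum_mult_antimono_ge) (auto simp: majorizes_def sum_subtractf)
  then show ?thesis
    using maj by (simp add: majorizes_def sum_subtractf left_diff_distrib)
qed

lemma majorizes_E_plus_sum_le:
  assumes "majorizes n x y" "x \<in> E_plus n" "y \<in> E_plus n"
    and "\<And>i j. 1 \<le> i \<Longrightarrow> i \<le> j \<Longrightarrow> j \<le> n \<Longrightarrow> l j \<le> l i"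
  shows "(\<Sum>i=1..n. x i * l i) \<le> (\<Sum>i=1..n. y i * l i)"
  using majorizes_sum_le[OF assms(1), of l] assms(2-) by (simp add: rearr_E_plus)

text \<open>Rearranging decreasing vectors reverses the index. Reversing the weights turns them
  increasing, and negating makes them decreasing again; the negation is what flips the inequality
  compared with increasing vectors.\<close>

lemma majorizes_D_plus_sum_le:
  assumes "majorizes n x y" "x \<in> D_plus n" "y \<in> D_plus n"
    and "\<And>i j. 1 \<le> i \<Longrightarrow> i \<le> j \<Longrightarrow> j \<le> n \<Longrightarrow> l j \<le> l i"
  shows "(\<Sum>i=1..n. y i * l i) \<le> (\<Sum>i=1..n. x i * l i)"
proof -
  have rev: "(\<Sum>i=1..n. rearr n z i * - l (n + 1 - i)) = - (\<Sum>i=1..n. z i * l i)"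
    if "z \<in> D_plus n" for z
  proof -
    have "(\<Sum>i=1..n. rearr n z i * - l (n + 1 - i))
        = (\<Sum>i=1..n. - (z (n + 1 - i) * l (n + 1 - i)))"
      using that by (intro sum.cong) (simp_all add: rearr_D_plus)
    also have "\<dots> = (\<Sum>i=1..n. - (z i * l i))"
      using sum.atLeastAtMost_rev[of "\<lambda>i. - (z i * l i)" 1 n] by (simp add: add.commute)
    finally show ?thesis by (simp add: sum_negf)
  qed
  have "(\<Sum>i=1..n. rearr n x i * - l (n + 1 - i)) \<le> (\<Sum>i=1..n. rearr n y i * - l (n + 1 - i))"
    using assms(4) by (intro majorizes_sum_le[OF assms(1)]) auto
  then show ?thesis
    using assms(2,3) by (simp only: rev)
qed

lemma prod_powr_le_prod_powr:
  fixes u x y :: "nat \<Rightarrow> real"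
  assumes "\<And>i. i \<in> {1..n} \<Longrightarrow> 0 < u i"
    and "(\<Sum>i=1..n. x i * ln (u i)) \<le> (\<Sum>i=1..n. y i * ln (u i))"
  shows "(\<Prod>i=1..n. u i powr x i) \<le> (\<Prod>i=1..n. u i powr y i)"
proof -
  have "(\<Prod>i=1..n. u i powr z i) = exp (\<Sum>i=1..n. z i * ln (u i))" for z
    \<comment> \<open>Positive bases are essential here: \<open>powr\<close> is \<open>exp\<close>
      of a multiple of \<open>ln\<close> except at base 0, where its value is 0.\<close>
    unfolding exp_sum[OF finite_atLeastAtMost]
    using assms(1) by (intro prod.cong) (fastforce simp: powr_def)+
  then show ?thesis using assms(2) by simp
qed

text \<open>This provides the weights for the summation by parts: along a decreasing \<alpha> they
  decrease in the index. The bound \<open>p powr a < 1\<close> keeps the arguments of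
  \<open>ln\<close> positive.\<close>

lemma ln_one_minus_powr_antimono:
  fixes p a b :: real
  assumes "0 \<le> p" "p < 1" "0 < a" "a \<le> b"
  shows "ln (1 - p powr a) \<le> ln (1 - p powr b)"
proof -
  have "p powr b \<le> p powr a"
    using assms by (intro powr_mono') auto
  moreover have "p powr a < 1"
    using assms powr_less_mono2[of a p 1] by simp
  ultimately show ?thesis by simp
qed

text \<open>The premise \<open>le\<close> abstracts from majorization, so that increasing and
  decreasing exponent vectors share one argument, with \<open>x\<close> and \<open>y\<close> in
  opposite roles.\<close>

lemma prod_KwG_survival_le:
  fixes \<alpha> x y :: "nat \<Rightarrow> real" and p :: real
  assumes "n \<ge> 1" "\<alpha> \<in> D_plus n" "0 \<le> p" "p \<le> 1"
    and le: "\<And>l :: nat \<Rightarrow> real. (\<And>i j. 1 \<le> i \<Longrightarrow> i \<le> j \<Longrightarrow> j \<le> n \<Longrightarrow> l j \<le> l i)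
        \<Longrightarrow> (\<Sum>i=1..n. x i * l i) \<le> (\<Sum>i=1..n. y i * l i)"
  shows "(\<Prod>i=1..n. (1 - p powr \<alpha> i) powr x i) \<le> (\<Prod>i=1..n. (1 - p powr \<alpha> i) powr y i)"
proof (cases "p = 1")
  case True
  then show ?thesis using \<open>n \<ge> 1\<close> by (simp add: prod_nonneg)
next
  case False
  with assms have p: "p < 1" by simp
  show ?thesis
  proof (rule prod_powr_le_prod_powr)
    fix i assume "i \<in> {1..n}"
    then show "0 < 1 - p powr \<alpha> i"
      using assms(2,3) p powr_less_mono2[of "\<alpha> i" p 1] by (simp add: D_plus_def)
  next
    show "(\<Sum>i=1..n. x i * ln (1 - p powr \<alpha> i)) \<le> (\<Sum>i=1..n. y i * ln (1 - p powr \<alpha> i))"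
      using assms(2,3) p by (intro le ln_one_minus_powr_antimono) (auto simp: D_plus_def)
  qed
qed

lemma prod_KwG_survival_antimono:
  fixes \<alpha> y :: "nat \<Rightarrow> real" and p q :: real
  assumes "\<And>i. i \<in> {1..n} \<Longrightarrow> 0 < \<alpha> i" "\<And>i. i \<in> {1..n} \<Longrightarrow> 0 < y i"
    and "0 \<le> q" "q \<le> p" "p \<le> 1"
  shows "(\<Prod>i=1..n. (1 - p powr \<alpha> i) powr y i) \<le> (\<Prod>i=1..n. (1 - q powr \<alpha> i) powr y i)"
proof (rule prod_mono)
  fix i assume "i \<in> {1..n}"
  then have "0 < \<alpha> i" "0 < y i" using assms by auto
  then have "q powr \<alpha> i \<le> p powr \<alpha> i" "p powr \<alpha> i \<le> 1"
    using assms(3-5) powr_mono2[of "\<alpha> i" p 1] by (auto intro: powr_mono2)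
  then show "0 \<le> (1 - p powr \<alpha> i) powr y i
      \<and> (1 - p powr \<alpha> i) powr y i \<le> (1 - q powr \<alpha> i) powr y i"
    using \<open>0 < y i\<close> by (auto intro: powr_mono2)
qed

lemma (in prob_space) dist_fun_eq_prob:
  assumes "X \<in> borel_measurable M"
  shows "dist_fun M X t = prob {\<omega> \<in> space M. X \<omega> \<le> t}"
proof -
  have "X -` {..t} \<inter> space M = {\<omega> \<in> space M. X \<omega> \<le> t}" by auto
  then show ?thesis
    using assms by (simp add: dist_fun_def cdf_def measure_distr)
qed

lemma (in prob_space) dist_fun_bounds:
  assumes "X \<in> borel_measurable M"
  shows "0 \<le> dist_fun M X t" "dist_fun M X t \<le> 1"
  using assms by (simp_all add: dist_fun_eq_prob)

lemma (in prob_space) dist_fun_eq_prob_greater: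
  assumes [measurable]: "X \<in> borel_measurable M"
  shows "dist_fun M X t = 1 - prob {\<omega> \<in> space M. t < X \<omega>}"
proof -
  have "{\<omega> \<in> space M. t < X \<omega>} = space M - {\<omega> \<in> space M. X \<omega> \<le> t}" by auto
  then show ?thesis
    by (simp add: dist_fun_eq_prob prob_compl)
qed

text \<open>The minimum exceeds \<open>t\<close> exactly when every \<open>W i\<close> does;
  independence turns the probability of this intersection into a product.\<close>

lemma (in prob_space) dist_fun_min_var:
  assumes n: "n \<ge> 1" and ind: "indep_vars (\<lambda>_. borel) W {1..n}"
  shows "dist_fun M (min_var n W) t = 1 - (\<Prod>i=1..n. 1 - dist_fun M (W i) t)"
proof -
  have W: "W i \<in> borel_measurable M" if "i \<in> {1..n}" for i
    using ind that by (auto simp: indep_vars_def)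
  have meas: "min_var n W \<in> borel_measurable M"
    unfolding min_var_def using n W by (intro borel_measurable_Min) auto
  have "{\<omega> \<in> space M. t < min_var n W \<omega>} = (\<Inter>i\<in>{1..n}. W i -` {t<..} \<inter> space M)"
    using n by (auto simp: min_var_def)
  then have "prob {\<omega> \<in> space M. t < min_var n W \<omega>} = (\<Prod>i=1..n. prob (W i -` {t<..} \<inter> space M))"
    using n indep_varsD[OF ind, of "{1..n}" "\<lambda>_. {t<..}"] by simp
  also have "\<dots> = (\<Prod>i=1..n. 1 - dist_fun M (W i) t)"
  proof (rule prod.cong)
    fix i assume "i \<in> {1..n}"
    moreover have "W i -` {t<..} \<inter> space M = {\<omega> \<in> space M. t < W i \<omega>}" by auto
    ultimately show "prob (W i -` {t<..} \<inter> space M) = 1 - dist_fun M (W i) t"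
      by (simp add: dist_fun_eq_prob_greater W)
  qed simp
  finally show ?thesis
    by (simp add: dist_fun_eq_prob_greater meas)
qed

lemma (in prob_space) dist_fun_min_var_KwG:
  assumes "n \<ge> 1" "indep_vars (\<lambda>_. borel) W {1..n}"
    and "\<And>i. i \<in> {1..n} \<Longrightarrow> KwG M (W i) (\<alpha> i) (\<beta> i) F"
  shows "dist_fun M (min_var n W) t = 1 - (\<Prod>i=1..n. (1 - F t powr \<alpha> i) powr \<beta> i)"
  using assms(3) by (simp add: dist_fun_min_var[OF assms(1,2)] KwG_def)

theorem theorem4p2:
  fixes n :: nat
    and M1 :: "'a measure" and M2 :: "'b measure" and MU :: "'c measure" and MV :: "'d measure"
    and X1 :: "'a \<Rightarrow> real" and X2 :: "'b \<Rightarrow> real"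
    and U :: "nat \<Rightarrow> 'c \<Rightarrow> real" and V :: "nat \<Rightarrow> 'd \<Rightarrow> real"
    and F1 F2 f1 f2 :: "real \<Rightarrow> real"
    and \<alpha> \<beta> \<delta> :: "nat \<Rightarrow> real"
  assumes "n \<ge> 1"
    and "prob_space M1" and "prob_space M2" and "prob_space MU" and "prob_space MV"
    and "X1 \<in> borel_measurable M1" and "X2 \<in> borel_measurable M2"
    and "F1 = dist_fun M1 X1" and "F2 = dist_fun M2 X2"
    and "continuous_on UNIV F1" and "continuous_on UNIV F2"
    and "\<And>x. f1 x \<ge> 0" and "\<And>x. f2 x \<ge> 0"
    and "distributed M1 lborel X1 (\<lambda>x. ennreal (f1 x))"
    and "distributed M2 lborel X2 (\<lambda>x. ennreal (f2 x))"
    and "prob_space.indep_vars MU (\<lambda>_. borel) U {1..n}"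
    and "prob_space.indep_vars MV (\<lambda>_. borel) V {1..n}"
    and "\<And>i. i \<in> {1..n} \<Longrightarrow> KwG MU (U i) (\<alpha> i) (\<beta> i) F1"
    and "\<And>i. i \<in> {1..n} \<Longrightarrow> KwG MV (V i) (\<alpha> i) (\<delta> i) F2"
    and "majorizes n \<beta> \<delta>"
    and "\<alpha> \<in> D_plus n"
  shows "(\<beta> \<in> E_plus n \<and> \<delta> \<in> E_plus n \<longrightarrow>
            le_st M1 X1 M2 X2 \<longrightarrow> le_st MU (min_var n U) MV (min_var n V)) \<and>
         (\<beta> \<in> D_plus n \<and> \<delta> \<in> D_plus n \<longrightarrow>
            le_st M2 X2 M1 X1 \<longrightarrow> le_st MV (min_var n V) MU (min_var n U))"
proof -
  interpret M1: prob_space M1 by fact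
  interpret M2: prob_space M2 by fact
  interpret MU: prob_space MU by fact
  interpret MV: prob_space MV by fact
  note n = \<open>n \<ge> 1\<close> and maj = \<open>majorizes n \<beta> \<delta>\<close> and \<alpha> = \<open>\<alpha> \<in> D_plus n\<close>
  have \<alpha>_pos: "0 < \<alpha> i" if "i \<in> {1..n}" for i
    using \<alpha> that by (simp add: D_plus_def)
  have \<delta>_pos: "0 < \<delta> i" if "i \<in> {1..n}" for i
    using assms(19)[OF that] by (simp add: KwG_def)
  have F1: "0 \<le> F1 t" "F1 t \<le> 1" and F2: "0 \<le> F2 t" "F2 t \<le> 1" for t
    using assms(6-9) M1.dist_fun_bounds M2.dist_fun_bounds by auto
  \<comment> \<open>\<open>?S p b\<close> is the survival probability of the minimum when the
    baseline distribution function takes the value \<open>p\<close> and the outer exponents are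
    \<open>b\<close>.\<close>
  let ?S = "\<lambda>p b. \<Prod>i=1..n. (1 - p powr \<alpha> i) powr b i"
  have U: "dist_fun MU (min_var n U) t = 1 - ?S (F1 t) \<beta>" for t
    by (rule MU.dist_fun_min_var_KwG) (use assms in auto)
  have V: "dist_fun MV (min_var n V) t = 1 - ?S (F2 t) \<delta>" for t
    by (rule MV.dist_fun_min_var_KwG) (use assms in auto)
  show ?thesis
  proof (intro conjI impI)
    assume E: "\<beta> \<in> E_plus n \<and> \<delta> \<in> E_plus n" and st: "le_st M1 X1 M2 X2"
    have "?S (F1 t) \<beta> \<le> ?S (F2 t) \<delta>" for t
    proof -
      \<comment> \<open>The passage goes through \<open>?S (F1 t) \<delta>\<close>: first the
        exponents change at fixed \<open>F1 t\<close>, then \<open>F1 t\<close> drops to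
        \<open>F2 t\<close>.\<close>
      have "?S (F1 t) \<beta> \<le> ?S (F1 t) \<delta>"
        using E by (intro prod_KwG_survival_le n \<alpha> F1 majorizes_E_plus_sum_le[OF maj]) auto
      also have "\<dots> \<le> ?S (F2 t) \<delta>"
        using st assms(8,9)
        by (intro prod_KwG_survival_antimono \<alpha>_pos \<delta>_pos F1 F2) (auto simp: le_st_def)
      finally show ?thesis .
    qed
    then show "le_st MU (min_var n U) MV (min_var n V)"
      by (simp add: le_st_def U V)
  next
    assume D: "\<beta> \<in> D_plus n \<and> \<delta> \<in> D_plus n" and st: "le_st M2 X2 M1 X1"
    have "?S (F2 t) \<delta> \<le> ?S (F1 t) \<beta>" for t
    proof -
      \<comment> \<open>The same intermediate product, reached from the other side: now
        \<open>F1 t \<le> F2 t\<close>, and decreasing vectors reverse the exponent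
        comparison.\<close>
      have "?S (F2 t) \<delta> \<le> ?S (F1 t) \<delta>"
        using st assms(8,9)
        by (intro prod_KwG_survival_antimono \<alpha>_pos \<delta>_pos F1 F2) (auto simp: le_st_def)
      also have "\<dots> \<le> ?S (F1 t) \<beta>"
        using D by (intro prod_KwG_survival_le n \<alpha> F1 majorizes_D_plus_sum_le[OF maj]) auto
      finally show ?thesis .
    qed
    then show "le_st MV (min_var n V) MU (min_var n U)"
      by (simp add: le_st_def U V)
  qed
qed

end
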